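(* Let $\boldsymbol{\mathcal{A}}=(\mathcal{A}_0,\dots,\mathcal{A}_n)$ be a family of nonempty finite subsets of a lattice $M$ of rank $n$, let $\boldsymbol{\rho}=(\rho_0,\dots,\rho_n)$ be a family of convex piecewise affine functions $\rho_i\colon\Delta_i\to\mathbb{R}$ defined on $\mathcal{A}_i$, with $\Delta_i=\operatorname{conv}(\mathcal{A}_i)$, whose inf-convolution $\rho$ induces a tight mixed subdivision $S(\rho)$ of $\Delta=\sum_i\Delta_i$, and let $\delta\in M_{\mathbb{R}}$ be generic with respect to $S(\rho)$. Let $\phi_i\colon\Delta_i\to\mathbb{R}$, $i=0,\dots,n$, be another family of convex piecewise affine functions with inf-convolution $\phi$, and suppose that $S(\phi)\preceq S(\rho)$. Let $D$ be an $n$-cell of $S(\phi)$ with components $D_0,\dots,D_n$, let $\mathcal{C}$ be a subset of $\mathcal{B}=(\Delta+\delta)\cap M$ and set $\mathcal{C}_D=\mathcal{C}\cap(D+\delta)$. Then the matrix $\mathcal{H}_{\boldsymbol{\mathcal{A}}_D,\boldsymbol{\rho}_D,\mathcal{C}_D}$ is the evaluation of the principal submatrix $\mathcal{H}_{\boldsymbol{\mathcal{A}},\boldsymbol{\rho},\mathcal{C}_D}$ by setting $u_{i,a}=0$ for $i=0,\dots,n$ and $a\in\mathcal{A}_i\setminus D_i$.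
   Context: Polyhedral notation. $M\simeq\mathbb{Z}^n$, $N=\operatorname{Hom}(M,\mathbb{Z})$, $M_{\mathbb{R}}=M\otimes\mathbb{R}$, $N_{\mathbb{R}}=N\otimes\mathbb{R}$. For a convex piecewise affine function $\rho\colon\Delta\to\mathbb{R}$ on a polytope and $v\in N_{\mathbb{R}}$ put $\Gamma(\rho,v)=\{x\in\Delta\mid \rho(x)+\langle v,x\rangle=\min_{y\in\Delta}(\rho(y)+\langle v,y\rangle)\}$. The subdivision $S(\rho)$ of $\Delta$ is the collection of all the sets $\Gamma(\rho,v)$, called cells; an $n$-cell is a cell of dimension $n$. The inf-convolution of $\rho_i\colon\Delta_i\to\mathbb{R}$, $i=0,\dots,n$, is $\rho=\boxplus_i\rho_i\colon\Delta=\sum_i\Delta_i\to\mathbb{R}$, $\rho(x)=\inf\{\sum_i\rho_i(x_i)\mid x_i\in\Delta_i,\sum_ix_i=x\}$, and $S(\rho)$ is called a mixed subdivision of $\Delta$. The $i$-th component of $C\in S(\rho)$ is the set $C_i$ of $x_i\in\Delta_i$ for which there are $x_j\in\Delta_j$, $j\ne i$, with $\sum_jx_j\in C$ and $\rho(\sum_jx_j)=\sum_j\rho_j(x_j)$; if $C=\Gamma(\rho,v)$ then $C_i=\Gamma(\rho_i,v)$. $S(\rho)$ is tight if $\sum_{i}\dim(C_i)=n$ for every $n$-cell $C$. One writes $S(\phi)\preceq S(\rho)$ if for every $C\in S(\rho)$ there is $D\in S(\phi)$ with $C\subset D$ and $C_i\subset D_i$ for all $i$. The function $\rho_i$ is defined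 on $\mathcal{A}_i$ if there is $\boldsymbol{\nu}_i\in\mathbb{R}^{\mathcal{A}_i}$ such that $\rho_i(x)=\min\{z\mid(x,z)\in\operatorname{conv}\{(a,\nu_{i,a})\}_{a\in\mathcal{A}_i}\}$ for all $x\in\Delta_i$. Genericity of $\delta$: $(|S(\rho)^{n-1}|+\delta)\cap M=\emptyset$, where $|S(\rho)^{n-1}|$ is the $(n-1)$-skeleton of $S(\rho)$, i.e. the union of its cells of dimension at most $n-1$. Canny-Emiris matrix. Let $\boldsymbol{u}_i=\{u_{i,a}\}_{a\in\mathcal{A}_i}$ be variables, $\boldsymbol{u}=(\boldsymbol{u}_0,\dots,\boldsymbol{u}_n)$ and $\mathbb{K}=\mathbb{C}(\boldsymbol{u})$. Each $b\in\mathcal{B}=(\Delta+\delta)\cap M$ lies in $C+\delta$ for a unique $n$-cell $C$ of $S(\rho)$; let $i(b)$ be the largest $i$ with $\dim(C_i)=0$, and $a(b)\in\mathcal{A}_{i(b)}$ the unique point of $C_{i(b)}$. The Canny-Emiris matrix $\mathcal{H}_{\boldsymbol{\mathcal{A}},\boldsymbol{\rho}}\in\mathbb{K}^{\mathcal{B}\times\mathcal{B}}$ has entry at $(b,b')$ equal to $u_{i(b),\,b'-b+a(b)}$ if $b'-b+a(b)\in\mathcal{A}_{i(b)}$, and $0$ otherwise. For a subset $\mathcal{C}'\subset\mathcal{B}$, $\mathcal{H}_{\boldsymbol{\mathcal{A}},\boldsymbol{\rho},\mathcal{C}'}$ is the principal submatrix indexed by $\mathcal{C}'$. Restriction. $\boldsymbol{\mathcal{A}}_D=(\mathcal{A}_i\cap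 D_i)_{i=0}^n$ and $\boldsymbol{\rho}_D=(\rho_i|_{D_i})_{i=0}^n$. The data $(\boldsymbol{\mathcal{A}}_D,\boldsymbol{\rho}_D,\delta)$ satisfies the hypotheses of the construction above with $\Delta$ replaced by $D$ and $\rho$ by $\boxplus_i\rho_i|_{D_i}$; its Canny-Emiris matrix $\mathcal{H}_{\boldsymbol{\mathcal{A}}_D,\boldsymbol{\rho}_D}$ is indexed by $\mathcal{B}\cap(D+\delta)$ and involves the variables $u_{i,a}$, $a\in\mathcal{A}_i\cap D_i$. $\mathcal{H}_{\boldsymbol{\mathcal{A}}_D,\boldsymbol{\rho}_D,\mathcal{C}_D}$ is its principal submatrix indexed by $\mathcal{C}_D$. *)

theory Defs
  imports
    "HOL-Analysis.Analysis"
    "HOL-Library.Poly_Mapping"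
    "HOL-Library.Set_Algebras"
    "HOL-Library.FuncSet"
    "HOL-Computational_Algebra.Fraction_Field"
begin

section \<open>Lattices and convex piecewise affine functions\<close>

text \<open>
  A lattice \<open>M\<close> of rank \<open>n\<close> is realised inside a Euclidean space as the integer span of \<open>n\<close>
  linearly independent vectors, so that \<open>M \<otimes> \<real>\<close> is \<^term>\<open>span M\<close>.  The ambient dimension may
  exceed \<open>n\<close>; in particular \<open>n = 0\<close> is allowed.  Elements of the dual space of \<^term>\<open>span M\<close>
  are represented by vectors via the inner product (vectors with the same orthogonal
  projection to \<^term>\<open>span M\<close> represent the same functional).
\<close>

definition lattice_of_rank :: "nat \<Rightarrow> 'a::euclidean_space set \<Rightarrow> bool" where
  "lattice_of_rank n M \<longleftrightarrow>
     (\<exists>B. finite B \<and> card B = n \<and> independent B \<and>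
          M = {\<Sum>b\<in>B. of_int (c b) *\<^sub>R b | c :: 'a \<Rightarrow> int. True})"

definition convex_piecewise_affine :: "'a::euclidean_space set \<Rightarrow> ('a \<Rightarrow> real) \<Rightarrow> bool" where
  "convex_piecewise_affine P f \<longleftrightarrow>
     convex_on P f \<and>
     (\<exists>\<Q>. finite \<Q> \<and> (\<forall>Q\<in>\<Q>. polytope Q) \<and> \<Union>\<Q> = P \<and>
          (\<forall>Q\<in>\<Q>. \<exists>w k. \<forall>x\<in>Q. f x = w \<bullet> x + k))"

text \<open>The value of \<open>f\<close> is the height of the lower hull of the lifted points \<open>(a, \<nu> a)\<close>.\<close>

definition defined_on :: "'a::euclidean_space set \<Rightarrow> 'a set \<Rightarrow> ('a \<Rightarrow> real) \<Rightarrow> bool" where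
  "defined_on A P f \<longleftrightarrow>
     (\<exists>\<nu> :: 'a \<Rightarrow> real. \<forall>x\<in>P.
        (x, f x) \<in> convex hull ((\<lambda>a. (a, \<nu> a)) ` A) \<and>
        (\<forall>z. (x, z) \<in> convex hull ((\<lambda>a. (a, \<nu> a)) ` A) \<longrightarrow> f x \<le> z))"


section \<open>Mixed subdivisions\<close>

definition cell :: "'a::euclidean_space set \<Rightarrow> ('a \<Rightarrow> real) \<Rightarrow> 'a \<Rightarrow> 'a set" where
  "cell P f v = {x \<in> P. \<forall>y\<in>P. f x + v \<bullet> x \<le> f y + v \<bullet> y}"

definition subdivision :: "'a::euclidean_space set \<Rightarrow> ('a \<Rightarrow> real) \<Rightarrow> 'a set set" where
  "subdivision P f = {cell P f v | v. True}"

text \<open>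
  Families are functions on \<^typ>\<open>nat\<close> of which only the members with index \<open>i \<le> n\<close> matter.
  A function on a polytope is given by the polytope and a total function, so that restricting
  a family of functions to subpolytopes only replaces the family \<open>P\<close> of domains.
\<close>

definition infconv ::
    "nat \<Rightarrow> (nat \<Rightarrow> 'a::euclidean_space set) \<Rightarrow> (nat \<Rightarrow> 'a \<Rightarrow> real) \<Rightarrow> 'a \<Rightarrow> real" where
  "infconv n P \<rho> x =
     Inf {\<Sum>i\<le>n. \<rho> i (y i) | y. (\<forall>i\<le>n. y i \<in> P i) \<and> (\<Sum>i\<le>n. y i) = x}"

definition mixed_subdivision ::
    "nat \<Rightarrow> (nat \<Rightarrow> 'a::euclidean_space set) \<Rightarrow> (nat \<Rightarrow> 'a \<Rightarrow> real) \<Rightarrow> 'a set set" where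
  "mixed_subdivision n P \<rho> = subdivision (\<Sum>i\<le>n. P i) (infconv n P \<rho>)"

definition n_cells ::
    "nat \<Rightarrow> (nat \<Rightarrow> 'a::euclidean_space set) \<Rightarrow> (nat \<Rightarrow> 'a \<Rightarrow> real) \<Rightarrow> 'a set set" where
  "n_cells n P \<rho> = {C \<in> mixed_subdivision n P \<rho>. aff_dim C = int n}"

definition cell_component ::
    "nat \<Rightarrow> (nat \<Rightarrow> 'a::euclidean_space set) \<Rightarrow> (nat \<Rightarrow> 'a \<Rightarrow> real) \<Rightarrow> 'a set \<Rightarrow> nat \<Rightarrow> 'a set" where
  "cell_component n P \<rho> C i =
     {x i | x. (\<forall>j\<le>n. x j \<in> P j) \<and> (\<Sum>j\<le>n. x j) \<in> C \<and>
               infconv n P \<rho> (\<Sum>j\<le>n. x j) = (\<Sum>j\<le>n. \<rho> j (x j))}"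

definition tight ::
    "nat \<Rightarrow> (nat \<Rightarrow> 'a::euclidean_space set) \<Rightarrow> (nat \<Rightarrow> 'a \<Rightarrow> real) \<Rightarrow> bool" where
  "tight n P \<rho> \<longleftrightarrow>
     (\<forall>C \<in> n_cells n P \<rho>. (\<Sum>i\<le>n. aff_dim (cell_component n P \<rho> C i)) = int n)"

text \<open>\<open>coarser n P \<phi> \<rho>\<close> is the relation \<open>S(\<phi>) \<preceq> S(\<rho>)\<close>.\<close>

definition coarser ::
    "nat \<Rightarrow> (nat \<Rightarrow> 'a::euclidean_space set) \<Rightarrow> (nat \<Rightarrow> 'a \<Rightarrow> real) \<Rightarrow> (nat \<Rightarrow> 'a \<Rightarrow> real) \<Rightarrow> bool"
  where
  "coarser n P \<phi> \<rho> \<longleftrightarrow>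
     (\<forall>C \<in> mixed_subdivision n P \<rho>. \<exists>D \<in> mixed_subdivision n P \<phi>.
        C \<subseteq> D \<and> (\<forall>i\<le>n. cell_component n P \<rho> C i \<subseteq> cell_component n P \<phi> D i))"

definition generic_shift ::
    "nat \<Rightarrow> 'a::euclidean_space set \<Rightarrow> (nat \<Rightarrow> 'a set) \<Rightarrow> (nat \<Rightarrow> 'a \<Rightarrow> real) \<Rightarrow> 'a \<Rightarrow> bool" where
  "generic_shift n M P \<rho> \<delta> \<longleftrightarrow>
     ((+) \<delta> ` \<Union>{C \<in> mixed_subdivision n P \<rho>. aff_dim C \<le> int n - 1}) \<inter> M = {}"


section \<open>The field of rational functions in the variables\<close>

text \<open>
  \<open>U i a\<close> is the name of the variable \<open>u\<^sub>i\<^sub>,\<^sub>a\<close>, \<open>fvar i a\<close> the variable itself as an element of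
  the field of rational functions.  There is one variable for every \<open>i\<close> and \<open>a\<close>, so that the
  matrices of all the families considered have their entries in the same field.
\<close>

datatype 'a uvar = U nat 'a

text \<open>
  The library proves that a polynomial ring \<open>('v \<Rightarrow>\<^sub>0 nat) \<Rightarrow>\<^sub>0 complex\<close> is an integral domain for
  linearly ordered \<open>'v\<close> only.  The order on the variables is an arbitrary one and plays no
  other role.
\<close>

instantiation uvar :: (type) linorder
begin

definition less_eq_uvar :: "'a uvar \<Rightarrow> 'a uvar \<Rightarrow> bool" where
  "less_eq_uvar x y \<longleftrightarrow> (x, y) \<in> (SOME r. well_order_on UNIV r)"

definition less_uvar :: "'a uvar \<Rightarrow> 'a uvar \<Rightarrow> bool" where
  "less_uvar x y \<longleftrightarrow> x \<le> y \<and> \<not> y \<le> x"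

instance
proof -
  define r :: "'a uvar rel" where "r = (SOME r. well_order_on UNIV r)"
  have "well_order_on UNIV r"
    unfolding r_def by (rule someI_ex) (rule well_order_on)
  then have r: "refl r" "trans r" "antisym r" "total r"
    by (simp_all add: well_order_on_def linear_order_on_def partial_order_on_def
        preorder_on_def)
  have le: "x \<le> y \<longleftrightarrow> (x, y) \<in> r" for x y :: "'a uvar"
    by (simp add: less_eq_uvar_def r_def)
  show "OFCLASS('a uvar, linorder_class)"
  proof
    fix x y z :: "'a uvar"
    show "x < y \<longleftrightarrow> x \<le> y \<and> \<not> y \<le> x" by (rule less_uvar_def)
    show "x \<le> x" using r(1) by (simp add: le refl_on_def)
    show "x \<le> y \<Longrightarrow> y \<le> z \<Longrightarrow> x \<le> z" using r(2) by (auto simp: le dest: transD)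
    show "x \<le> y \<Longrightarrow> y \<le> x \<Longrightarrow> x = y" using r(3) by (auto simp: le dest: antisymD)
    show "x \<le> y \<or> y \<le> x"
      using r(1,4) by (cases "x = y") (auto simp: le refl_on_def total_on_def)
  qed
qed

end

type_synonym 'a upoly = "('a uvar \<Rightarrow>\<^sub>0 nat) \<Rightarrow>\<^sub>0 complex"
type_synonym 'a ufield = "'a upoly fract"

definition pvar :: "'a uvar \<Rightarrow> 'a upoly" where
  "pvar x = Poly_Mapping.single (Poly_Mapping.single x 1) 1"

definition fvar :: "nat \<Rightarrow> 'a \<Rightarrow> 'a ufield" where
  "fvar i a = Fract (pvar (U i a)) 1"

definition poly_subst :: "('a uvar \<Rightarrow> 'a upoly) \<Rightarrow> 'a upoly \<Rightarrow> 'a upoly" where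
  "poly_subst \<sigma> p =
     (\<Sum>m \<in> Poly_Mapping.keys p. Poly_Mapping.single 0 (Poly_Mapping.lookup p m) *
        (\<Prod>x \<in> Poly_Mapping.keys m. \<sigma> x ^ Poly_Mapping.lookup m x))"

definition set_zero :: "'a uvar set \<Rightarrow> 'a uvar \<Rightarrow> 'a upoly" where
  "set_zero Z x = (if x \<in> Z then 0 else pvar x)"

text \<open>
  \<open>is_evaluation Z f g\<close>: the rational function \<open>f\<close> can be evaluated at \<open>x = 0\<close> for all variables
  \<open>x \<in> Z\<close> (it has a denominator not vanishing there), and the result is \<open>g\<close>.
\<close>

definition is_evaluation :: "'a uvar set \<Rightarrow> 'a ufield \<Rightarrow> 'a ufield \<Rightarrow> bool" where
  "is_evaluation Z f g \<longleftrightarrow>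
     (\<exists>p q. f = Fract p q \<and> poly_subst (set_zero Z) q \<noteq> 0 \<and>
            g = Fract (poly_subst (set_zero Z) p) (poly_subst (set_zero Z) q))"


section \<open>Canny--Emiris matrices\<close>

definition ce_index ::
    "nat \<Rightarrow> 'a::euclidean_space set \<Rightarrow> (nat \<Rightarrow> 'a set) \<Rightarrow> 'a \<Rightarrow> 'a set" where
  "ce_index n M P \<delta> = ((+) \<delta> ` (\<Sum>i\<le>n. P i)) \<inter> M"

definition ce_cell ::
    "nat \<Rightarrow> (nat \<Rightarrow> 'a::euclidean_space set) \<Rightarrow> (nat \<Rightarrow> 'a \<Rightarrow> real) \<Rightarrow> 'a \<Rightarrow> 'a \<Rightarrow> 'a set" where
  "ce_cell n P \<rho> \<delta> b = (THE C. C \<in> n_cells n P \<rho> \<and> b \<in> (+) \<delta> ` C)"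

definition row_index ::
    "nat \<Rightarrow> (nat \<Rightarrow> 'a::euclidean_space set) \<Rightarrow> (nat \<Rightarrow> 'a \<Rightarrow> real) \<Rightarrow> 'a \<Rightarrow> 'a \<Rightarrow> nat" where
  "row_index n P \<rho> \<delta> b =
     Max {i. i \<le> n \<and> aff_dim (cell_component n P \<rho> (ce_cell n P \<rho> \<delta> b) i) = 0}"

definition row_point ::
    "nat \<Rightarrow> (nat \<Rightarrow> 'a::euclidean_space set) \<Rightarrow> (nat \<Rightarrow> 'a \<Rightarrow> real) \<Rightarrow> 'a \<Rightarrow> 'a \<Rightarrow> 'a" where
  "row_point n P \<rho> \<delta> b =
     the_elem (cell_component n P \<rho> (ce_cell n P \<rho> \<delta> b) (row_index n P \<rho> \<delta> b))"

text \<open>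
  A matrix with rows and columns indexed by a set \<open>I\<close> is an extensional function on \<open>I \<times> I\<close>.
  In the situation of interest \<open>P i\<close> is the convex hull of \<open>A i\<close>.
\<close>

definition ce_matrix ::
    "nat \<Rightarrow> 'a::euclidean_space set \<Rightarrow> (nat \<Rightarrow> 'a set) \<Rightarrow> (nat \<Rightarrow> 'a set) \<Rightarrow>
     (nat \<Rightarrow> 'a \<Rightarrow> real) \<Rightarrow> 'a \<Rightarrow> 'a \<times> 'a \<Rightarrow> 'a ufield" where
  "ce_matrix n M A P \<rho> \<delta> =
     restrict
       (\<lambda>(b, b').
          let i = row_index n P \<rho> \<delta> b; a = b' - b + row_point n P \<rho> \<delta> b
          in if a \<in> A i then fvar i a else 0)
       (ce_index n M P \<delta> \<times> ce_index n M P \<delta>)"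

definition principal_submatrix :: "('a \<times> 'a \<Rightarrow> 'k) \<Rightarrow> 'a set \<Rightarrow> 'a \<times> 'a \<Rightarrow> 'k" where
  "principal_submatrix H I = restrict H (I \<times> I)"

end

theory Submission
  imports Defs
begin

text \<open>
  The entry of a Canny--Emiris matrix at \<open>(b, b')\<close> depends on the cell \<open>C\<close> of \<open>S(\<rho>)\<close> with
  \<open>b \<in> C + \<delta>\<close> only through the components of \<open>C\<close>.  So it suffices that, for \<open>b \<in> D + \<delta>\<close>, the
  same \<open>C\<close> with the same components is found in the data restricted to \<open>D\<close>.  The two entries
  then agree except when the variable belongs to a point outside of the component of \<open>D\<close>, where
  the restricted matrix has a zero and the evaluation produces one.

  Put \<open>x = b - \<delta>\<close> and let \<open>C\<close> be a cell of \<open>S(\<rho>)\<close> containing \<open>x\<close>, given by the functional \<open>w\<close>.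
  Everything rests on one rigidity property (\<open>generic_point_functional_orthogonal\<close>): as \<open>x\<close> is in
  no cell of dimension less than \<open>n\<close>, a functional that attains its minimum over \<open>C\<close> at \<open>x\<close> vanishes on
  \<open>M \<otimes> \<real>\<close>.  Whenever two functionals \<open>w\<close>, \<open>w'\<close> define cells of the same function through
  \<open>x\<close>, the difference \<open>w' - w\<close> is minimal at \<open>x\<close> over the cell of \<open>w\<close>
  (\<open>cell_inner_diff_le\<close>).  Applied to three functions, this shows that

  \<^item> \<open>C\<close> is the only cell of \<open>S(\<rho>)\<close> containing \<open>x\<close>;
  \<^item> the cell \<open>D'\<close> of \<open>S(\<phi>)\<close> which contains \<open>C\<close> by \<open>S(\<phi>) \<preceq> S(\<rho>)\<close> is \<open>D\<close>, hence the components
    satisfy \<open>C\<^sub>i \<subseteq> D\<^sub>i\<close>;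
  \<^item> in the restricted subdivision too, there is only one cell through \<open>x\<close>.

  By the second point the minimum of \<open>\<rho>\<^sub>i + w\<close> over \<open>\<Delta>\<^sub>i\<close> is attained in \<open>D\<^sub>i\<close>, on the same set
  \<open>C\<^sub>i\<close>.  Cells of an inf-convolution are the Minkowski sums of the cells of the summands
  (\<open>cell_infconv\<close>), so \<open>w\<close> defines \<open>C\<close> in the restricted subdivision as well, with the same components
  (\<open>cell_component_cell\<close>).

  The rigidity property and the existence of a cell through \<open>x\<close> use that \<open>\<rho>\<close> is polyhedral, in the
  form that its graph is the lower boundary of a polytope (\<open>lower_hull\<close>).
\<close>

section \<open>Cells of a function\<close>

lemma cell_subset: "cell P f v \<subseteq> P"
  by (auto simp: cell_def)

lemma in_cellD: "x \<in> cell P f v \<Longrightarrow> y \<in> P \<Longrightarrow> f x + v \<bullet> x \<le> f y + v \<bullet> y"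
  by (simp add: cell_def)

lemma cell_value_eq:
  "x \<in> cell P f v \<Longrightarrow> y \<in> cell P f v \<Longrightarrow> f x + v \<bullet> x = f y + v \<bullet> y"
  unfolding cell_def by (blast intro: order_antisym)

lemma cell_nonempty:
  assumes "compact P" "P \<noteq> {}" "continuous_on P f"
  shows "cell P f v \<noteq> {}"
proof -
  have "continuous_on P (\<lambda>x. f x + v \<bullet> x)"
    using assms(3) by (intro continuous_intros)
  then obtain x where "x \<in> P" "\<forall>y\<in>P. f x + v \<bullet> x \<le> f y + v \<bullet> y"
    using continuous_attains_inf[OF assms(1,2)] by blast
  then show ?thesis
    by (auto simp: cell_def)
qed

lemma compact_cell:
  assumes "compact P" "continuous_on P f"
  shows "compact (cell P f v)"
proof -
  have "closed {x \<in> P. f x + v \<bullet> x \<le> f y + v \<bullet> y}" for y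
    using assms by (intro continuous_on_closed_Collect_le continuous_intros compact_imp_closed)
  then have "closed (\<Inter>y\<in>P. {x \<in> P. f x + v \<bullet> x \<le> f y + v \<bullet> y})"
    by (intro closed_INT) blast
  then have "compact (P \<inter> (\<Inter>y\<in>P. {x \<in> P. f x + v \<bullet> x \<le> f y + v \<bullet> y}))"
    by (rule compact_Int_closed[OF assms(1)])
  also have "P \<inter> (\<Inter>y\<in>P. {x \<in> P. f x + v \<bullet> x \<le> f y + v \<bullet> y}) = cell P f v"
    by (auto simp: cell_def)
  finally show ?thesis .
qed

lemma cell_restrict:
  assumes "cell P f v \<noteq> {}" "cell P f v \<subseteq> Q" "Q \<subseteq> P"
  shows "cell Q f v = cell P f v"
proof
  show "cell P f v \<subseteq> cell Q f v"
    using assms(2,3) by (auto simp: cell_def)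
  obtain x where x: "x \<in> cell P f v"
    using assms(1) by blast
  show "cell Q f v \<subseteq> cell P f v"
  proof
    fix y assume y: "y \<in> cell Q f v"
    have "x \<in> Q"
      using x assms(2) by blast
    then have "f y + v \<bullet> y \<le> f x + v \<bullet> x"
      using y by (rule in_cellD[rotated])
    moreover have "y \<in> P"
      using y cell_subset assms(3) by blast
    ultimately show "y \<in> cell P f v"
      using x by (force simp: cell_def)
  qed
qed

lemma cell_cong_inner:
  assumes "\<And>x. x \<in> P \<Longrightarrow> v \<bullet> x = w \<bullet> x"
  shows "cell P f v = cell P f w"
  using assms by (auto simp: cell_def)

lemma cell_inner_diff_le:
  assumes "x \<in> cell P f w" "x \<in> cell P f w'" "y \<in> cell P f w"
  shows "(w' - w) \<bullet> x \<le> (w' - w) \<bullet> y"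
proof -
  have "f x + w \<bullet> x = f y + w \<bullet> y"
    using assms(1,3) by (rule cell_value_eq)
  moreover have "f x + w' \<bullet> x \<le> f y + w' \<bullet> y"
    using assms(2,3) cell_subset by (blast intro: in_cellD)
  ultimately show ?thesis
    by (simp add: inner_diff_left)
qed

lemma convex_piecewise_affine_compact:
  assumes "convex_piecewise_affine P f"
  shows "compact P"
  using assms unfolding convex_piecewise_affine_def
  by (auto intro!: compact_Union intro: polytope_imp_compact)

lemma convex_piecewise_affine_continuous:
  assumes "convex_piecewise_affine P f"
  shows "continuous_on P f"
proof -
  obtain \<Q> where \<Q>: "finite \<Q>" "\<forall>Q\<in>\<Q>. polytope Q" "\<Union>\<Q> = P"
      and aff: "\<forall>Q\<in>\<Q>. \<exists>w k. \<forall>x\<in>Q. f x = w \<bullet> x + k"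
    using assms unfolding convex_piecewise_affine_def by blast
  have "continuous_on (\<Union>Q\<in>\<Q>. Q) f"
  proof (rule continuous_on_closed_Union[OF \<Q>(1)])
    fix Q assume Q: "Q \<in> \<Q>"
    then show "closed Q"
      using \<Q>(2) polytope_imp_closed by blast
    obtain w k where "\<forall>x\<in>Q. f x = w \<bullet> x + k"
      using aff Q by blast
    then show "continuous_on Q f"
      by (subst continuous_on_cong[where g = "\<lambda>x. w \<bullet> x + k"]) (auto intro!: continuous_intros)
  qed
  then show ?thesis
    using \<Q>(3) by simp
qed


section \<open>Cells of an inf-convolution\<close>

lemma in_set_sum_iff:
  fixes P :: "nat \<Rightarrow> 'b::comm_monoid_add set"
  shows "x \<in> (\<Sum>i\<le>n. P i) \<longleftrightarrow> (\<exists>y. (\<forall>i\<le>n. y i \<in> P i) \<and> (\<Sum>i\<le>n. y i) = x)"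
  by (auto simp: set_sum_alt)

lemma compact_set_sum:
  fixes P :: "nat \<Rightarrow> 'b::real_normed_vector set"
  assumes "\<And>i. i \<le> n \<Longrightarrow> compact (P i)"
  shows "compact (\<Sum>i\<le>n. P i)"
  using assms
proof (induction n)
  case (Suc n)
  have "(\<Sum>i\<le>n. P i) + P (Suc n) = {x + y | x y. x \<in> (\<Sum>i\<le>n. P i) \<and> y \<in> P (Suc n)}"
    by (auto simp: set_plus_def)
  moreover have "compact \<dots>"
    using Suc by (intro compact_sums) auto
  ultimately show ?case
    by simp
qed simp

text \<open>
  The values competing in the infimum form the fibre over \<open>x\<close> of the Minkowski sum of the graphs,
  and this sum is compact.
\<close>

lemma infconv_is_minimum:
  fixes P :: "nat \<Rightarrow> 'a::euclidean_space set"
  assumes P: "\<forall>i\<le>n. compact (P i) \<and> continuous_on (P i) (\<rho> i)"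
    and x: "x \<in> (\<Sum>i\<le>n. P i)"
  shows "\<exists>y. (\<forall>i\<le>n. y i \<in> P i) \<and> (\<Sum>i\<le>n. y i) = x \<and> infconv n P \<rho> x = (\<Sum>i\<le>n. \<rho> i (y i))"
    and "\<lbrakk>\<forall>i\<le>n. y i \<in> P i; (\<Sum>i\<le>n. y i) = x\<rbrakk> \<Longrightarrow> infconv n P \<rho> x \<le> (\<Sum>i\<le>n. \<rho> i (y i))"
proof -
  define V where "V = {\<Sum>i\<le>n. \<rho> i (y i) | y. (\<forall>i\<le>n. y i \<in> P i) \<and> (\<Sum>i\<le>n. y i) = x}"
  define G where "G = (\<Sum>i\<le>n. (\<lambda>z. (z, \<rho> i z)) ` P i)"
  have "compact G"
    unfolding G_def using P by (intro compact_set_sum compact_continuous_image continuous_intros) auto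
  then have "compact (snd ` (G \<inter> {x} \<times> UNIV))"
    by (intro compact_continuous_image compact_Int_closed continuous_intros closed_Times) auto
  also have "snd ` (G \<inter> {x} \<times> UNIV) = V"
  proof (intro equalityI subsetI)
    fix t assume "t \<in> snd ` (G \<inter> {x} \<times> UNIV)"
    then have "(x, t) \<in> G" by auto
    then obtain p where p: "\<forall>i\<le>n. p i \<in> (\<lambda>z. (z, \<rho> i z)) ` P i" "(\<Sum>i\<le>n. p i) = (x, t)"
      unfolding G_def in_set_sum_iff by blast
    have "\<forall>i\<le>n. fst (p i) \<in> P i" and rho: "\<And>i. i \<le> n \<Longrightarrow> snd (p i) = \<rho> i (fst (p i))"
      using p(1) by auto
    moreover have "(\<Sum>i\<le>n. fst (p i)) = x"
      using arg_cong[OF p(2), of fst] by (simp add: fst_sum)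
    moreover have "(\<Sum>i\<le>n. \<rho> i (fst (p i))) = t"
      using arg_cong[OF p(2), of snd] rho by (simp add: snd_sum)
    ultimately show "t \<in> V"
      unfolding V_def by (intro CollectI exI[of _ "\<lambda>i. fst (p i)"]) simp
  next
    fix t assume "t \<in> V"
    then obtain y where y: "\<forall>i\<le>n. y i \<in> P i" "(\<Sum>i\<le>n. y i) = x" "t = (\<Sum>i\<le>n. \<rho> i (y i))"
      unfolding V_def by blast
    then have "(x, t) = (\<Sum>i\<le>n. (y i, \<rho> i (y i)))"
      by (simp add: sum_prod)
    then have "(x, t) \<in> G"
      using y(1) unfolding G_def in_set_sum_iff by (intro exI[of _ "\<lambda>i. (y i, \<rho> i (y i))"]) auto
    then show "t \<in> snd ` (G \<inter> {x} \<times> UNIV)"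
      by force
  qed
  finally have V: "compact V" .
  have "V \<noteq> {}"
    using x unfolding V_def in_set_sum_iff by blast
  moreover have bdd: "bdd_below V"
    using V by (simp add: bounded_imp_bdd_below compact_imp_bounded)
  ultimately have "Inf V \<in> V"
    using V by (intro closed_contains_Inf) (auto simp: compact_imp_closed)
  moreover have V_eq: "infconv n P \<rho> x = Inf V"
    by (simp add: infconv_def V_def)
  ultimately have "infconv n P \<rho> x \<in> V"
    by simp
  then show "\<exists>y. (\<forall>i\<le>n. y i \<in> P i) \<and> (\<Sum>i\<le>n. y i) = x \<and> infconv n P \<rho> x = (\<Sum>i\<le>n. \<rho> i (y i))"
    unfolding V_def by blast
  show "infconv n P \<rho> x \<le> (\<Sum>i\<le>n. \<rho> i (y i))"
    if "\<forall>i\<le>n. y i \<in> P i" "(\<Sum>i\<le>n. y i) = x"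
    unfolding V_eq using that by (intro cInf_lower bdd) (auto simp: V_def)
qed

text \<open>
  Minimising a sum of functions of independent variables means minimising each of them, so that
  a decomposition of a point of a cell is optimal iff all its members lie in the cells of the
  summands for the same functional.
\<close>

lemma decomposition_in_cell_iff:
  fixes P :: "nat \<Rightarrow> 'a::euclidean_space set"
  assumes P: "\<forall>i\<le>n. compact (P i) \<and> continuous_on (P i) (\<rho> i)"
    and y: "\<forall>i\<le>n. y i \<in> P i"
  shows "(\<Sum>i\<le>n. y i) \<in> cell (\<Sum>i\<le>n. P i) (infconv n P \<rho>) w \<and>
           infconv n P \<rho> (\<Sum>i\<le>n. y i) = (\<Sum>i\<le>n. \<rho> i (y i)) \<longleftrightarrow>
         (\<forall>i\<le>n. y i \<in> cell (P i) (\<rho> i) w)" (is "?L \<longleftrightarrow> ?R")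
proof
  assume L: ?L
  show ?R
  proof (intro allI impI)
    fix i assume i: "i \<le> n"
    have "\<rho> i (y i) + w \<bullet> y i \<le> \<rho> i p + w \<bullet> p" if p: "p \<in> P i" for p
    proof -
      \<comment> \<open>Exchanging one member of the decomposition compares \<open>y i\<close> with \<open>p\<close> alone.\<close>
      define z where "z = y(i := p)"
      have z: "\<forall>j\<le>n. z j \<in> P j"
        using y p by (simp add: z_def)
      then have zS: "(\<Sum>j\<le>n. z j) \<in> (\<Sum>j\<le>n. P j)"
        unfolding in_set_sum_iff by blast
      have "(\<Sum>j\<le>n. \<rho> j (y j) + w \<bullet> y j) = infconv n P \<rho> (\<Sum>j\<le>n. y j) + w \<bullet> (\<Sum>j\<le>n. y j)"
        using L by (simp add: sum.distrib inner_sum_right)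
      also have "\<dots> \<le> infconv n P \<rho> (\<Sum>j\<le>n. z j) + w \<bullet> (\<Sum>j\<le>n. z j)"
        using L zS by (intro in_cellD) auto
      also have "\<dots> \<le> (\<Sum>j\<le>n. \<rho> j (z j)) + w \<bullet> (\<Sum>j\<le>n. z j)"
        using infconv_is_minimum(2)[OF P zS z] by simp
      also have "\<dots> = (\<Sum>j\<le>n. \<rho> j (z j) + w \<bullet> z j)"
        by (simp add: sum.distrib inner_sum_right)
      finally have "(\<Sum>j\<le>n. \<rho> j (y j) + w \<bullet> y j) \<le> (\<Sum>j\<le>n. \<rho> j (z j) + w \<bullet> z j)" .
      moreover have "(\<Sum>j\<in>{..n} - {i}. \<rho> j (z j) + w \<bullet> z j) = (\<Sum>j\<in>{..n} - {i}. \<rho> j (y j) + w \<bullet> y j)"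
        by (intro sum.cong) (auto simp: z_def)
      ultimately show ?thesis
        using i by (simp add: sum.remove[of "{..n}" i] z_def)
    qed
    then show "y i \<in> cell (P i) (\<rho> i) w"
      using y i by (simp add: cell_def)
  qed
next
  assume R: ?R
  have yS: "(\<Sum>i\<le>n. y i) \<in> (\<Sum>i\<le>n. P i)"
    using y unfolding in_set_sum_iff by blast
  have le: "(\<Sum>i\<le>n. \<rho> i (y i)) + w \<bullet> (\<Sum>i\<le>n. y i) \<le> infconv n P \<rho> z + w \<bullet> z"
    if zS: "z \<in> (\<Sum>i\<le>n. P i)" for z
  proof -
    obtain p where p: "\<forall>i\<le>n. p i \<in> P i" "(\<Sum>i\<le>n. p i) = z" "infconv n P \<rho> z = (\<Sum>i\<le>n. \<rho> i (p i))"
      using infconv_is_minimum(1)[OF P zS] by blast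
    have "(\<Sum>i\<le>n. \<rho> i (y i) + w \<bullet> y i) \<le> (\<Sum>i\<le>n. \<rho> i (p i) + w \<bullet> p i)"
      using R p(1) by (intro sum_mono) (auto intro: in_cellD)
    then show ?thesis
      using p(2,3) by (simp add: sum.distrib inner_sum_right flip: p(2))
  qed
  have "infconv n P \<rho> (\<Sum>i\<le>n. y i) = (\<Sum>i\<le>n. \<rho> i (y i))"
    using le[OF yS] infconv_is_minimum(2)[OF P yS y] by simp
  then show ?L
    using le yS by (simp add: cell_def)
qed

lemma cell_infconv:
  fixes P :: "nat \<Rightarrow> 'a::euclidean_space set"
  assumes P: "\<forall>i\<le>n. compact (P i) \<and> continuous_on (P i) (\<rho> i)"
  shows "cell (\<Sum>i\<le>n. P i) (infconv n P \<rho>) w = (\<Sum>i\<le>n. cell (P i) (\<rho> i) w)"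
proof (intro equalityI subsetI)
  fix x assume x: "x \<in> cell (\<Sum>i\<le>n. P i) (infconv n P \<rho>) w"
  then have "x \<in> (\<Sum>i\<le>n. P i)"
    using cell_subset by blast
  then obtain y where "\<forall>i\<le>n. y i \<in> P i" "(\<Sum>i\<le>n. y i) = x" "infconv n P \<rho> x = (\<Sum>i\<le>n. \<rho> i (y i))"
    using infconv_is_minimum(1)[OF P] by blast
  then show "x \<in> (\<Sum>i\<le>n. cell (P i) (\<rho> i) w)"
    using decomposition_in_cell_iff[OF P, of y w] x unfolding in_set_sum_iff by blast
next
  fix x assume "x \<in> (\<Sum>i\<le>n. cell (P i) (\<rho> i) w)"
  then obtain y where y: "\<forall>i\<le>n. y i \<in> cell (P i) (\<rho> i) w" "(\<Sum>i\<le>n. y i) = x"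
    unfolding in_set_sum_iff by blast
  moreover have "\<forall>i\<le>n. y i \<in> P i"
    using y(1) cell_subset by blast
  ultimately show "x \<in> cell (\<Sum>i\<le>n. P i) (infconv n P \<rho>) w"
    using decomposition_in_cell_iff[OF P, of y w] by blast
qed

lemma cell_component_cell:
  fixes P :: "nat \<Rightarrow> 'a::euclidean_space set"
  assumes P: "\<forall>i\<le>n. compact (P i) \<and> continuous_on (P i) (\<rho> i)"
    and ne: "\<And>i. i \<le> n \<Longrightarrow> P i \<noteq> {}"
    and i: "i \<le> n"
  shows "cell_component n P \<rho> (cell (\<Sum>i\<le>n. P i) (infconv n P \<rho>) w) i = cell (P i) (\<rho> i) w"
proof (intro equalityI subsetI)
  fix p assume "p \<in> cell_component n P \<rho> (cell (\<Sum>i\<le>n. P i) (infconv n P \<rho>) w) i"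
  then show "p \<in> cell (P i) (\<rho> i) w"
    unfolding cell_component_def using decomposition_in_cell_iff[OF P, of _ w] i by blast
next
  fix p assume p: "p \<in> cell (P i) (\<rho> i) w"
  have "cell (P j) (\<rho> j) w \<noteq> {}" if "j \<le> n" for j
    using P ne that by (simp add: cell_nonempty)
  then have "\<forall>j\<in>{..n}. \<exists>q. q \<in> cell (P j) (\<rho> j) w"
    by blast
  then obtain q where q: "\<And>j. j \<le> n \<Longrightarrow> q j \<in> cell (P j) (\<rho> j) w"
    unfolding bchoice_iff by auto
  define y where "y = q(i := p)"
  have y: "\<forall>j\<le>n. y j \<in> cell (P j) (\<rho> j) w"
    using p q by (simp add: y_def)
  then have yP: "\<forall>j\<le>n. y j \<in> P j"
    using cell_subset by blast
  have "p = y i"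
    by (simp add: y_def)
  then show "p \<in> cell_component n P \<rho> (cell (\<Sum>i\<le>n. P i) (infconv n P \<rho>) w) i"
    unfolding cell_component_def using decomposition_in_cell_iff[OF P yP, of w] y yP by blast
qed


section \<open>Lower hulls of finite sets of lifted points\<close>

text \<open>
  Unlike in \<^const>\<open>defined_on\<close>, several lifted points may lie over the same point of \<open>S\<close>.
  This happens for the sums of lifted points that describe an inf-convolution.
\<close>

definition lower_hull :: "('a::euclidean_space \<times> real) set \<Rightarrow> 'a set \<Rightarrow> ('a \<Rightarrow> real) \<Rightarrow> bool" where
  "lower_hull L S g \<longleftrightarrow> finite L \<and> (\<forall>x\<in>S. (x, g x) \<in> convex hull L) \<and>
     (\<forall>x z. (x, z) \<in> convex hull L \<longrightarrow> x \<in> S \<and> g x \<le> z)"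

lemma defined_on_imp_lower_hull:
  assumes "finite A" "defined_on A (convex hull A) f"
  shows "\<exists>L. lower_hull L (convex hull A) f"
proof -
  obtain \<nu> :: "'a \<Rightarrow> real" where \<nu>: "\<forall>x\<in>convex hull A.
      (x, f x) \<in> convex hull ((\<lambda>a. (a, \<nu> a)) ` A) \<and>
      (\<forall>z. (x, z) \<in> convex hull ((\<lambda>a. (a, \<nu> a)) ` A) \<longrightarrow> f x \<le> z)"
    using assms(2) unfolding defined_on_def by blast
  have "x \<in> convex hull A" if "(x, z) \<in> convex hull ((\<lambda>a. (a, \<nu> a)) ` A)" for x z
  proof -
    have "fst ` (convex hull ((\<lambda>a. (a, \<nu> a)) ` A)) = convex hull (fst ` (\<lambda>a. (a, \<nu> a)) ` A)"
      by (simp add: convex_hull_linear_image linear_fst)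
    moreover have "fst ` (\<lambda>a. (a, \<nu> a)) ` A = A"
      by force
    ultimately show ?thesis
      using that by force
  qed
  then show ?thesis
    using assms(1) \<nu> unfolding lower_hull_def
    by (intro exI[of _ "(\<lambda>a. (a, \<nu> a)) ` A"]) auto
qed

text \<open>
  The epigraph of an inf-convolution is the Minkowski sum of the epigraphs, and convex hulls
  commute with Minkowski sums.
\<close>

lemma lower_hull_infconv:
  fixes P :: "nat \<Rightarrow> 'a::euclidean_space set"
  assumes P: "\<forall>i\<le>n. compact (P i) \<and> continuous_on (P i) (\<rho> i)"
    and L: "\<And>i. i \<le> n \<Longrightarrow> lower_hull (L i) (P i) (\<rho> i)"
  shows "lower_hull (\<Sum>i\<le>n. L i) (\<Sum>i\<le>n. P i) (infconv n P \<rho>)"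
  unfolding lower_hull_def
proof (intro conjI ballI allI impI)
  show "finite (\<Sum>i\<le>n. L i)"
    using L by (intro finite_set_sum) (auto simp: lower_hull_def)
next
  fix x assume "x \<in> (\<Sum>i\<le>n. P i)"
  then obtain y where y: "\<forall>i\<le>n. y i \<in> P i" "(\<Sum>i\<le>n. y i) = x"
      "infconv n P \<rho> x = (\<Sum>i\<le>n. \<rho> i (y i))"
    using infconv_is_minimum(1)[OF P] by blast
  have "(x, infconv n P \<rho> x) = (\<Sum>i\<le>n. (y i, \<rho> i (y i)))"
    using y(2,3) by (simp add: sum_prod)
  moreover have "(\<Sum>i\<le>n. (y i, \<rho> i (y i))) \<in> (\<Sum>i\<le>n. convex hull (L i))"
    unfolding in_set_sum_iff using y(1) L
    by (intro exI[of _ "\<lambda>i. (y i, \<rho> i (y i))"]) (auto simp: lower_hull_def)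
  ultimately show "(x, infconv n P \<rho> x) \<in> convex hull (\<Sum>i\<le>n. L i)"
    by (simp add: convex_hull_set_sum)
next
  fix x z assume "(x, z) \<in> convex hull (\<Sum>i\<le>n. L i)"
  then obtain p where p: "\<forall>i\<le>n. p i \<in> convex hull (L i)" "(\<Sum>i\<le>n. p i) = (x, z)"
    unfolding convex_hull_set_sum in_set_sum_iff by blast
  have "fst (p i) \<in> P i \<and> \<rho> i (fst (p i)) \<le> snd (p i)" if "i \<le> n" for i
    using p(1) L[OF that] that unfolding lower_hull_def by (metis prod.collapse)
  then have fp: "\<forall>i\<le>n. fst (p i) \<in> P i" and le: "\<And>i. i \<le> n \<Longrightarrow> \<rho> i (fst (p i)) \<le> snd (p i)"
    by auto
  have x: "(\<Sum>i\<le>n. fst (p i)) = x" and z: "(\<Sum>i\<le>n. snd (p i)) = z"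
    using arg_cong[OF p(2), of fst] arg_cong[OF p(2), of snd] by (simp_all add: fst_sum snd_sum)
  show xS: "x \<in> (\<Sum>i\<le>n. P i)"
    unfolding in_set_sum_iff using fp x by (intro exI[of _ "\<lambda>i. fst (p i)"]) simp
  have "infconv n P \<rho> x \<le> (\<Sum>i\<le>n. \<rho> i (fst (p i)))"
    using infconv_is_minimum(2)[OF P xS fp x] .
  also have "\<dots> \<le> z"
    unfolding z[symmetric] using le by (intro sum_mono) auto
  finally show "infconv n P \<rho> x \<le> z" .
qed

text \<open>
  The polytope over which \<open>g\<close> is the lower boundary is cut out by finitely many closed half
  spaces.  Lowering \<open>(x, g x)\<close> by an arbitrarily small amount leaves the polytope, hence violates
  one fixed inequality for arbitrarily small amounts.  This inequality is therefore an equality at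
  \<open>(x, g x)\<close>, and its boundary hyperplane is not vertical.  This works at the relative boundary
  of \<open>S\<close> too, where a supporting hyperplane of the epigraph might be vertical.
\<close>

lemma lower_hull_cells_cover:
  assumes L: "lower_hull L S g" and x: "x \<in> S"
  shows "\<exists>w. x \<in> cell S g w"
proof -
  have "polytope (convex hull L)"
    using L unfolding lower_hull_def polytope_def by blast
  then have "polyhedron (convex hull L)"
    by (rule polytope_imp_polyhedron)
  then obtain F where F: "finite F" "convex hull L = \<Inter>F"
      "\<forall>h\<in>F. \<exists>a b. a \<noteq> 0 \<and> h = {x. a \<bullet> x \<le> b}"
    unfolding polyhedron_def by (elim exE conjE)
  have "\<exists>h\<in>F. (x, g x - t) \<notin> h" if "t > 0" for t
  proof -
    have "(x, g x - t) \<notin> convex hull L"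
      using L that by (force simp: lower_hull_def)
    then show ?thesis
      using F(2) by blast
  qed
  then have "\<forall>k. \<exists>h\<in>F. (x, g x - 1 / real (Suc k)) \<notin> h"
    by simp
  then obtain h where h: "\<And>k. h k \<in> F" "\<And>k. (x, g x - 1 / real (Suc k)) \<notin> h k"
    by metis
  have "finite (range h)"
    using h(1) F(1) by (meson finite_subset image_subsetI)
  then obtain k0 where "infinite {k \<in> UNIV. h k = h k0}"
    using pigeonhole_infinite[of UNIV h] by auto
  then have inf: "infinite {k. h k = h k0}"
    by simp
  obtain c d where cd: "h k0 = {p. c \<bullet> p \<le> d}"
    using bspec[OF F(3) h(1)[of k0]] by (elim exE conjE)
  obtain \<alpha> \<beta> where c: "c = (\<alpha>, \<beta>)"
    by (cases c)
  have viol: "\<alpha> \<bullet> x + \<beta> * g x - \<beta> / real (Suc k) > d" if "h k = h k0" for k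
    using h(2)[of k] that by (simp add: cd c algebra_simps)
  have hull: "\<alpha> \<bullet> y + \<beta> * z \<le> d" if "(y, z) \<in> convex hull L" for y z
  proof -
    have "(y, z) \<in> h k0"
      using that F(2) h(1) by blast
    then show ?thesis
      by (simp add: cd c)
  qed
  have gx: "\<alpha> \<bullet> x + \<beta> * g x \<le> d"
    using L x by (intro hull) (simp add: lower_hull_def)
  have \<beta>: "\<beta> < 0"
  proof (rule ccontr)
    assume "\<not> \<beta> < 0"
    then have "\<beta> / real (Suc k0) \<ge> 0"
      by simp
    then show False
      using viol[of k0] gx by simp
  qed
  have "\<alpha> \<bullet> x + \<beta> * g x \<ge> d"
  proof (rule ccontr)
    assume "\<not> ?thesis"
    then have "0 < (d - (\<alpha> \<bullet> x + \<beta> * g x)) / - \<beta>"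
      using \<beta> by (simp add: field_simps)
    then obtain m where m: "1 / real (Suc m) < (d - (\<alpha> \<bullet> x + \<beta> * g x)) / - \<beta>"
      using nat_approx_posE by blast
    obtain k where k: "k \<ge> m" "h k = h k0"
      using inf unfolding infinite_nat_iff_unbounded_le by blast
    have "1 / real (Suc k) \<le> 1 / real (Suc m)"
      using k(1) by (simp add: frac_le)
    then have "1 / real (Suc k) < (d - (\<alpha> \<bullet> x + \<beta> * g x)) / - \<beta>"
      using m by simp
    then have "1 / real (Suc k) * - \<beta> < d - (\<alpha> \<bullet> x + \<beta> * g x)"
      using \<beta> by (subst (asm) pos_less_divide_eq) auto
    then show False
      using viol[OF k(2)] by simp
  qed
  then have d: "d = \<alpha> \<bullet> x + \<beta> * g x"
    using gx by simp
  have "g x + ((1 / \<beta>) *\<^sub>R \<alpha>) \<bullet> x \<le> g y + ((1 / \<beta>) *\<^sub>R \<alpha>) \<bullet> y" if "y \<in> S" for y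
  proof -
    have "\<alpha> \<bullet> y + \<beta> * g y \<le> \<alpha> \<bullet> x + \<beta> * g x"
      using L that hull[of y "g y"] d by (simp add: lower_hull_def)
    then have "(\<alpha> \<bullet> x + \<beta> * g x) / \<beta> \<le> (\<alpha> \<bullet> y + \<beta> * g y) / \<beta>"
      using \<beta> by (intro divide_right_mono_neg) auto
    then show ?thesis
      using \<beta> by (simp add: add_divide_distrib)
  qed
  then have "x \<in> cell S g ((1 / \<beta>) *\<^sub>R \<alpha>)"
    using x unfolding cell_def by blast
  then show ?thesis ..
qed

text \<open>
  Faces of cells are cells: a small tilt of the functional in the direction of \<open>u\<close> selects the
  face of \<open>cell S g w\<close> on which \<open>u\<close> is minimal, because only finitely many lifted points compete
  and those outside of the cell lose by a positive margin.
\<close>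

lemma lower_hull_tilted_cell:
  assumes L: "lower_hull L S g" and x: "x \<in> cell S g w"
    and min: "\<And>y. y \<in> cell S g w \<Longrightarrow> u \<bullet> x \<le> u \<bullet> y"
  shows "\<exists>\<epsilon>0>0. \<forall>\<epsilon>. 0 < \<epsilon> \<and> \<epsilon> \<le> \<epsilon>0 \<longrightarrow> x \<in> cell S g (w + \<epsilon> *\<^sub>R u)"
proof -
  define good where "good = (\<lambda>\<epsilon> (a, z). g x + (w + \<epsilon> *\<^sub>R u) \<bullet> x \<le> z + (w + \<epsilon> *\<^sub>R u) \<bullet> a)"
  have "eventually (\<lambda>\<epsilon>. good \<epsilon> p) (at_right 0)" if p: "p \<in> L" for p
  proof -
    obtain a z where az: "p = (a, z)"
      by (cases p)
    have "(a, z) \<in> convex hull L"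
      using p az by (simp add: hull_inc)
    then have a: "a \<in> S" "g a \<le> z"
      using L by (auto simp: lower_hull_def)
    then have le: "g x + w \<bullet> x \<le> g a + w \<bullet> a"
      using x by (auto intro: in_cellD)
    show ?thesis
    proof (cases "g x + w \<bullet> x = z + w \<bullet> a")
      case True
      then have "g a + w \<bullet> a = g x + w \<bullet> x"
        using le a by simp
      then have "a \<in> cell S g w"
        using x a(1) by (simp add: cell_def)
      then have "u \<bullet> x \<le> u \<bullet> a"
        by (rule min)
      then have scaled: "\<epsilon> * (u \<bullet> x) \<le> \<epsilon> * (u \<bullet> a)" if "\<epsilon> > 0" for \<epsilon>
        using that by simp
      have "good \<epsilon> p" if "\<epsilon> > 0" for \<epsilon>
        unfolding good_def az prod.case inner_add_left inner_scaleR_left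
        using scaled[OF that] True by linarith
      then show ?thesis
        by (auto intro: eventually_mono[OF eventually_at_right_less])
    next
      case False
      then have "g x + w \<bullet> x < z + w \<bullet> a"
        using le a by simp
      then have "0 < (z + (w + 0 *\<^sub>R u) \<bullet> a) - (g x + (w + 0 *\<^sub>R u) \<bullet> x)"
        by simp
      moreover have "((\<lambda>\<epsilon>. (z + (w + \<epsilon> *\<^sub>R u) \<bullet> a) - (g x + (w + \<epsilon> *\<^sub>R u) \<bullet> x)) \<longlongrightarrow>
          (z + (w + 0 *\<^sub>R u) \<bullet> a) - (g x + (w + 0 *\<^sub>R u) \<bullet> x)) (at_right 0)"
        by (intro tendsto_intros)
      ultimately have "eventually (\<lambda>\<epsilon>. 0 < (z + (w + \<epsilon> *\<^sub>R u) \<bullet> a) - (g x + (w + \<epsilon> *\<^sub>R u) \<bullet> x)) (at_right 0)"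
        by (rule order_tendstoD(1)[rotated])
      then show ?thesis
        by (auto simp: good_def az elim: eventually_mono)
    qed
  qed
  then have "eventually (\<lambda>\<epsilon>. \<forall>p\<in>L. good \<epsilon> p) (at_right 0)"
    using L by (intro eventually_ball_finite) (auto simp: lower_hull_def)
  then obtain b :: real where b: "b > 0" "\<And>\<epsilon>. 0 < \<epsilon> \<Longrightarrow> \<epsilon> < b \<Longrightarrow> \<forall>p\<in>L. good \<epsilon> p"
    unfolding eventually_at_right_field by blast
  have "x \<in> cell S g (w + \<epsilon> *\<^sub>R u)" if \<epsilon>: "0 < \<epsilon>" "\<epsilon> \<le> b / 2" for \<epsilon>
  proof -
    define v where "v = w + \<epsilon> *\<^sub>R u"
    have "L \<subseteq> {p. (v, 1) \<bullet> p \<ge> g x + v \<bullet> x}"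
    proof
      fix p assume "p \<in> L"
      then have "good \<epsilon> p"
        using b \<epsilon> by simp
      then show "p \<in> {p. (v, 1) \<bullet> p \<ge> g x + v \<bullet> x}"
        by (cases p) (simp add: good_def v_def)
    qed
    then have hull: "convex hull L \<subseteq> {p. (v, 1) \<bullet> p \<ge> g x + v \<bullet> x}"
      by (intro hull_minimal convex_halfspace_ge)
    have "g x + v \<bullet> x \<le> g y + v \<bullet> y" if "y \<in> S" for y
    proof -
      have "(y, g y) \<in> convex hull L"
        using L that by (simp add: lower_hull_def)
      then have "(y, g y) \<in> {p. (v, 1) \<bullet> p \<ge> g x + v \<bullet> x}"
        using hull by (rule rev_subsetD)
      then show ?thesis
        by simp
    qed
    then show ?thesis
      using x by (simp add: cell_def v_def)
  qed
  then show ?thesis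
    using b(1) by (intro exI[of _ "b / 2"]) auto
qed

text \<open>
  A point in no cell of dimension less than \<open>n\<close> is in the relative interior of its cell, where a
  nonconstant functional has no minimum.  In terms of tilts: \<open>x\<close> lies in the cells of \<open>w\<close> and of \<open>w + 2 \<epsilon> u\<close>, and on the
  cell of the intermediate \<open>w + \<epsilon> u\<close> the functional \<open>u\<close> is constant.  That cell contains \<open>x\<close> as well
  and therefore spans all of \<open>V\<close>.
\<close>

lemma generic_point_functional_orthogonal:
  assumes L: "lower_hull L S g" and V: "subspace V" "S \<subseteq> V" "dim V \<le> n"
    and generic: "\<And>v. x \<in> cell S g v \<Longrightarrow> int n \<le> aff_dim (cell S g v)"
    and x: "x \<in> cell S g w"
    and min: "\<And>y. y \<in> cell S g w \<Longrightarrow> u \<bullet> x \<le> u \<bullet> y"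
    and p: "p \<in> V"
  shows "u \<bullet> p = 0"
proof -
  obtain \<epsilon>0 where \<epsilon>0: "\<epsilon>0 > 0" "\<And>\<epsilon>. 0 < \<epsilon> \<and> \<epsilon> \<le> \<epsilon>0 \<Longrightarrow> x \<in> cell S g (w + \<epsilon> *\<^sub>R u)"
    using lower_hull_tilted_cell[OF L x min] by blast
  define E where "E = cell S g (w + (\<epsilon>0 / 2) *\<^sub>R u)"
  have xE: "x \<in> E"
    unfolding E_def using \<epsilon>0(1) by (intro \<epsilon>0(2)) simp
  have const: "u \<bullet> (y - x) = 0" if y: "y \<in> E" for y
  proof -
    have yS: "y \<in> S"
      using y cell_subset unfolding E_def by blast
    have "g x + w \<bullet> x \<le> g y + w \<bullet> y"
      using x yS by (rule in_cellD)
    moreover have "g x + (w + \<epsilon>0 *\<^sub>R u) \<bullet> x \<le> g y + (w + \<epsilon>0 *\<^sub>R u) \<bullet> y"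
      using \<epsilon>0 yS by (intro in_cellD[where P = S]) auto
    moreover have "g x + (w + (\<epsilon>0 / 2) *\<^sub>R u) \<bullet> x = g y + (w + (\<epsilon>0 / 2) *\<^sub>R u) \<bullet> y"
      using xE y unfolding E_def by (rule cell_value_eq)
    ultimately have "\<epsilon>0 * (u \<bullet> x) = \<epsilon>0 * (u \<bullet> y)"
      unfolding inner_add_left inner_scaleR_left by linarith
    then show ?thesis
      using \<epsilon>0(1) by (simp add: inner_diff_right)
  qed
  define T where "T = (\<lambda>y. y - x) ` E"
  have "int n \<le> aff_dim E"
    using generic xE unfolding E_def by blast
  moreover have "aff_dim E = int (dim T)"
    unfolding T_def using xE by (intro aff_dim_eq_dim_subtract) (rule hull_inc)
  moreover have "E \<subseteq> V"
    using V(2) cell_subset unfolding E_def by (rule order_trans[rotated])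
  then have "T \<subseteq> V"
    using V(1) xE by (auto simp: T_def intro!: subspace_diff)
  ultimately have "span T = span V"
    using V(3) by (intro dim_eq_span) auto
  then have "p \<in> span T"
    using p span_superset by blast
  moreover have "span T \<subseteq> {q. u \<bullet> q = 0}"
    using const by (intro span_minimal subspace_hyperplane) (auto simp: T_def)
  ultimately show ?thesis
    by blast
qed


section \<open>Evaluation of the entries\<close>

lemma poly_subst_one: "poly_subst \<sigma> 1 = 1"
proof -
  have "poly_subst \<sigma> (Poly_Mapping.single 0 1) = 1"
    unfolding poly_subst_def by simp
  then show ?thesis by simp
qed

lemma poly_subst_pvar: "poly_subst \<sigma> (pvar x) = \<sigma> x"
  by (simp add: poly_subst_def pvar_def)

lemma is_evaluation_zero: "is_evaluation Z 0 0"
proof -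
  have "poly_subst (set_zero Z) 0 = 0"
    by (simp add: poly_subst_def)
  then show ?thesis
    unfolding is_evaluation_def
    by (intro exI[of _ 0] exI[of _ 1]) (simp add: poly_subst_one Zero_fract_def)
qed

lemma is_evaluation_fvar:
  "is_evaluation Z (fvar i a) (if U i a \<in> Z then 0 else fvar i a)"
  unfolding is_evaluation_def fvar_def
  by (intro exI[of _ "pvar (U i a)"] exI[of _ 1])
     (simp add: poly_subst_one poly_subst_pvar set_zero_def Zero_fract_def)


section \<open>Restriction to a cell of a coarser subdivision\<close>

lemma dim_span_lattice:
  assumes "lattice_of_rank n M"
  shows "dim (span M) \<le> n"
proof -
  obtain B where B: "finite B" "card B = n"
      "M = {\<Sum>b\<in>B. of_int (c b) *\<^sub>R b | c :: 'a \<Rightarrow> int. True}"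
    using assms unfolding lattice_of_rank_def by blast
  have "M \<subseteq> span B"
    unfolding B(3) by (auto intro!: span_sum span_scale intro: span_base)
  then show ?thesis
    using dim_le_card[of "span M" B] B(1,2) by (simp add: span_minimal)
qed

lemma ce_cell_eqI:
  assumes "C \<in> n_cells n P \<rho>" "b \<in> (+) \<delta> ` C"
    and "\<And>C'. C' \<in> n_cells n P \<rho> \<Longrightarrow> b \<in> (+) \<delta> ` C' \<Longrightarrow> C' = C"
  shows "ce_cell n P \<rho> \<delta> b = C"
  unfolding ce_cell_def by (rule the_equality) (use assms in blast)+

theorem proposition4p9:
  fixes M :: "'a::euclidean_space set"
    and A \<Delta> Dc :: "nat \<Rightarrow> 'a set"
    and \<rho> \<phi> :: "nat \<Rightarrow> 'a \<Rightarrow> real"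
    and \<delta> :: 'a
    and D \<C> \<C>\<^sub>D :: "'a set"
    and n :: nat
  assumes "lattice_of_rank n M"
    and "\<And>i. i \<le> n \<Longrightarrow> finite (A i) \<and> A i \<noteq> {} \<and> A i \<subseteq> M"
    and "\<Delta> = (\<lambda>i. convex hull (A i))"
    and "\<And>i. i \<le> n \<Longrightarrow> convex_piecewise_affine (\<Delta> i) (\<rho> i) \<and> defined_on (A i) (\<Delta> i) (\<rho> i)"
    and "tight n \<Delta> \<rho>"
    and "\<delta> \<in> span M"
    and "generic_shift n M \<Delta> \<rho> \<delta>"
    and "\<And>i. i \<le> n \<Longrightarrow> convex_piecewise_affine (\<Delta> i) (\<phi> i)"
    and "coarser n \<Delta> \<phi> \<rho>"
    and "D \<in> n_cells n \<Delta> \<phi>"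
    and "Dc = cell_component n \<Delta> \<phi> D"
    and "\<C> \<subseteq> ce_index n M \<Delta> \<delta>"
    and "\<C>\<^sub>D = \<C> \<inter> (+) \<delta> ` D"
  shows "\<C>\<^sub>D \<subseteq> ce_index n M Dc \<delta> \<and>
    (\<forall>b\<in>\<C>\<^sub>D. \<forall>b'\<in>\<C>\<^sub>D.
       is_evaluation {U i a | i a. i \<le> n \<and> a \<in> A i - Dc i}
         (principal_submatrix (ce_matrix n M A \<Delta> \<rho> \<delta>) \<C>\<^sub>D (b, b'))
         (principal_submatrix (ce_matrix n M (\<lambda>i. A i \<inter> Dc i) Dc \<rho> \<delta>) \<C>\<^sub>D (b, b')))"
proof -
  note lattice = assms(1) and A = assms(2) and \<Delta> = assms(3) and \<rho> = assms(4)
    and tight = assms(5) and generic = assms(7) and \<phi> = assms(8) and coarser = assms(9)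
    and D = assms(10) and Dc = assms(11) and CB = assms(12) and CD = assms(13)
  have \<Delta>_ne: "\<Delta> i \<noteq> {}" if "i \<le> n" for i
    using A[OF that] by (simp add: \<Delta>)
  have reg\<rho>: "\<forall>i\<le>n. compact (\<Delta> i) \<and> continuous_on (\<Delta> i) (\<rho> i)"
    using \<rho> convex_piecewise_affine_compact convex_piecewise_affine_continuous by metis
  have reg\<phi>: "\<forall>i\<le>n. compact (\<Delta> i) \<and> continuous_on (\<Delta> i) (\<phi> i)"
    using \<phi> convex_piecewise_affine_compact convex_piecewise_affine_continuous by metis
  define S where "S = (\<Sum>i\<le>n. \<Delta> i)"
  define g where "g = infconv n \<Delta> \<rho>"
  define V where "V = span M"
  have V: "subspace V" "dim V \<le> n"
    using dim_span_lattice[OF lattice] by (auto simp: V_def)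
  have \<Delta>V: "\<Delta> i \<subseteq> V" if "i \<le> n" for i
    unfolding \<Delta> V_def using A[OF that] span_superset
    by (intro hull_minimal subspace_imp_convex subspace_span) auto
  have SV: "S \<subseteq> V"
  proof
    fix x assume "x \<in> S"
    then obtain y where "\<forall>i\<le>n. y i \<in> \<Delta> i" "(\<Sum>i\<le>n. y i) = x"
      unfolding S_def in_set_sum_iff by blast
    then show "x \<in> V"
      using \<Delta>V V(1) by (auto intro!: subspace_sum)
  qed
  have "\<forall>i. \<exists>L. i \<le> n \<longrightarrow> lower_hull L (\<Delta> i) (\<rho> i)"
    using defined_on_imp_lower_hull A \<rho> unfolding \<Delta> by blast
  then obtain L where "\<And>i. i \<le> n \<Longrightarrow> lower_hull (L i) (\<Delta> i) (\<rho> i)"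
    by metis
  then have hull: "lower_hull (\<Sum>i\<le>n. L i) S g"
    unfolding S_def g_def using reg\<rho> by (intro lower_hull_infconv)

  obtain v where v: "D = cell S (infconv n \<Delta> \<phi>) v"
    using D by (auto simp: n_cells_def mixed_subdivision_def subdivision_def S_def)
  have Dc_eq: "Dc i = cell (\<Delta> i) (\<phi> i) v" if "i \<le> n" for i
    unfolding Dc v S_def using reg\<phi> \<Delta>_ne that by (rule cell_component_cell)
  have Dc_sub: "Dc i \<subseteq> \<Delta> i" if "i \<le> n" for i
    unfolding Dc_eq[OF that] by (rule cell_subset)
  have Dc_ne: "Dc i \<noteq> {}" if "i \<le> n" for i
    unfolding Dc_eq[OF that] using reg\<phi> \<Delta>_ne that by (simp add: cell_nonempty)
  have regD: "\<forall>i\<le>n. compact (Dc i) \<and> continuous_on (Dc i) (\<rho> i)"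
    using reg\<phi> reg\<rho> compact_cell Dc_eq Dc_sub by (metis continuous_on_subset)
  have "D = (\<Sum>i\<le>n. cell (\<Delta> i) (\<phi> i) v)"
    unfolding v S_def using reg\<phi> by (rule cell_infconv)
  also have "\<dots> = (\<Sum>i\<le>n. Dc i)"
    using Dc_eq by simp
  finally have D_sum: "D = (\<Sum>i\<le>n. Dc i)" .
  have DS: "D \<subseteq> S"
    unfolding v by (rule cell_subset)

  \<comment> \<open>The restricted data select the same cell, with the same components.\<close>
  have same_cell: "row_index n \<Delta> \<rho> \<delta> b = row_index n Dc \<rho> \<delta> b \<and>
      row_point n \<Delta> \<rho> \<delta> b = row_point n Dc \<rho> \<delta> b \<and> row_index n \<Delta> \<rho> \<delta> b \<le> n"
    if b: "b \<in> \<C>\<^sub>D" for b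
  proof -
    obtain x where x: "x \<in> D" "b = \<delta> + x"
      using b CD by blast
    have bM: "b \<in> M"
      using b CD CB by (auto simp: ce_index_def)
    have xS: "x \<in> S"
      using x DS by blast
    have gen: "int n \<le> aff_dim (cell S g w)" if "x \<in> cell S g w" for w
    proof (rule ccontr)
      assume "\<not> ?thesis"
      then have "cell S g w \<in> {C \<in> mixed_subdivision n \<Delta> \<rho>. aff_dim C \<le> int n - 1}"
        by (auto simp: mixed_subdivision_def subdivision_def S_def g_def)
      then have "b \<in> (+) \<delta> ` \<Union>{C \<in> mixed_subdivision n \<Delta> \<rho>. aff_dim C \<le> int n - 1}"
        using that x(2) by blast
      then show False
        using generic bM unfolding generic_shift_def by blast
    qed
    obtain w where w: "x \<in> cell S g w"
      using lower_hull_cells_cover[OF hull xS] by blast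
    define C where "C = cell S g w"
    have ortho: "u \<bullet> p = 0" if "\<And>y. y \<in> C \<Longrightarrow> u \<bullet> x \<le> u \<bullet> y" "p \<in> V" for u p
      using that by (intro generic_point_functional_orthogonal[OF hull V(1) SV V(2) gen w]) (auto simp: C_def)
    have C_mixed: "C \<in> mixed_subdivision n \<Delta> \<rho>"
      by (auto simp: C_def mixed_subdivision_def subdivision_def S_def g_def)
    have "aff_dim C \<le> aff_dim V"
      using SV cell_subset unfolding C_def by (intro aff_dim_subset) blast
    then have dimC: "aff_dim C = int n"
      using gen[OF w] V by (simp add: C_def aff_dim_subspace)
    have C_cell: "C \<in> n_cells n \<Delta> \<rho>"
      using C_mixed dimC by (simp add: n_cells_def)
    have bC: "b \<in> (+) \<delta> ` C"
      using x(2) w by (simp add: C_def)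
    have comp: "cell_component n \<Delta> \<rho> C i = cell (\<Delta> i) (\<rho> i) w" if "i \<le> n" for i
      unfolding C_def S_def g_def using reg\<rho> \<Delta>_ne that by (rule cell_component_cell)
    have comp_ne: "cell (\<Delta> i) (\<rho> i) w \<noteq> {}" if "i \<le> n" for i
      using reg\<rho> \<Delta>_ne that by (simp add: cell_nonempty)

    have cell1: "ce_cell n \<Delta> \<rho> \<delta> b = C"
    proof (rule ce_cell_eqI[OF C_cell bC])
      fix C' assume C': "C' \<in> n_cells n \<Delta> \<rho>" "b \<in> (+) \<delta> ` C'"
      then obtain w' where w': "C' = cell S g w'"
        by (auto simp: n_cells_def mixed_subdivision_def subdivision_def S_def g_def)
      have "x \<in> cell S g w'"
        using C'(2) x(2) w' by auto
      then have "(w' - w) \<bullet> p = 0" if "p \<in> V" for p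
        using that cell_inner_diff_le[OF w] by (intro ortho) (auto simp: C_def)
      then show "C' = C"
        unfolding w' C_def using SV by (intro cell_cong_inner) (auto simp: inner_diff_left)
    qed

    \<comment> \<open>The cell of \<open>S(\<phi>)\<close> given by coarseness has the components of \<open>D\<close>, because both contain \<open>x\<close>.\<close>
    obtain D' where D': "D' \<in> mixed_subdivision n \<Delta> \<phi>" "C \<subseteq> D'"
        "\<forall>i\<le>n. cell_component n \<Delta> \<rho> C i \<subseteq> cell_component n \<Delta> \<phi> D' i"
      using coarser C_mixed unfolding coarser_def by blast
    obtain v' where v': "D' = cell S (infconv n \<Delta> \<phi>) v'"
      using D'(1) by (auto simp: mixed_subdivision_def subdivision_def S_def)
    have "(v - v') \<bullet> x \<le> (v - v') \<bullet> y" if "y \<in> C" for y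
      using that D'(2) w x(1) v v' by (intro cell_inner_diff_le) (auto simp: C_def)
    then have "(v - v') \<bullet> p = 0" if "p \<in> V" for p
      using that by (intro ortho)
    then have "cell (\<Delta> i) (\<phi> i) v' = cell (\<Delta> i) (\<phi> i) v" if "i \<le> n" for i
      using \<Delta>V[OF that] by (intro cell_cong_inner) (auto simp: inner_diff_left)
    moreover have "cell_component n \<Delta> \<phi> D' i = cell (\<Delta> i) (\<phi> i) v'" if "i \<le> n" for i
      unfolding v' S_def using reg\<phi> \<Delta>_ne that by (rule cell_component_cell)
    ultimately have sub: "cell (\<Delta> i) (\<rho> i) w \<subseteq> Dc i" if "i \<le> n" for i
      using D'(3) comp Dc_eq that by simp

    have cells: "cell (Dc i) (\<rho> i) w = cell (\<Delta> i) (\<rho> i) w" if "i \<le> n" for i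
      using comp_ne sub Dc_sub that by (intro cell_restrict)
    \<comment> \<open>Hence \<open>w\<close> defines the same cell for the inf-convolution of the restricted functions.\<close>
    define h where "h = infconv n Dc \<rho>"
    have "cell D h w = (\<Sum>i\<le>n. cell (Dc i) (\<rho> i) w)"
      unfolding D_sum h_def using regD by (rule cell_infconv)
    also have "\<dots> = (\<Sum>i\<le>n. cell (\<Delta> i) (\<rho> i) w)"
      using cells by simp
    also have "\<dots> = C"
      unfolding C_def S_def g_def using reg\<rho> by (rule cell_infconv[symmetric])
    finally have C_D: "cell D h w = C" .
    have C_cell_D: "C \<in> n_cells n Dc \<rho>"
      using C_D dimC by (auto simp: n_cells_def mixed_subdivision_def subdivision_def D_sum h_def)
    have cell2: "ce_cell n Dc \<rho> \<delta> b = C"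
    proof (rule ce_cell_eqI[OF C_cell_D bC])
      fix C' assume C': "C' \<in> n_cells n Dc \<rho>" "b \<in> (+) \<delta> ` C'"
      then obtain w' where w': "C' = cell D h w'"
        by (auto simp: n_cells_def mixed_subdivision_def subdivision_def D_sum h_def)
      have "x \<in> cell D h w'" "x \<in> cell D h w"
        using C'(2) x(2) w' w C_D C_def by auto
      then have "(w' - w) \<bullet> p = 0" if "p \<in> V" for p
        using that cell_inner_diff_le[of x D h w w'] by (intro ortho) (auto simp: C_D)
      then show "C' = C"
        unfolding w' C_D[symmetric] using SV DS
        by (intro cell_cong_inner) (auto simp: inner_diff_left)
    qed
    have comp_D: "cell_component n Dc \<rho> C i = cell_component n \<Delta> \<rho> C i" if "i \<le> n" for i
    proof -
      have "cell_component n Dc \<rho> C i = cell (Dc i) (\<rho> i) w"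
        unfolding C_D[symmetric] D_sum h_def using regD Dc_ne that by (rule cell_component_cell)
      then show ?thesis
        using cells comp that by simp
    qed

    define J where "J = {i. i \<le> n \<and> aff_dim (cell_component n \<Delta> \<rho> C i) = 0}"
    \<comment> \<open>By tightness \<open>n + 1\<close> nonnegative dimensions add up to \<open>n\<close>, so one of them is zero.\<close>
    have "J \<noteq> {}"
    proof
      assume "J = {}"
      have "1 \<le> aff_dim (cell_component n \<Delta> \<rho> C i)" if i: "i \<le> n" for i
      proof -
        have "aff_dim (cell_component n \<Delta> \<rho> C i) \<noteq> 0"
          using \<open>J = {}\<close> i by (auto simp: J_def)
        moreover have "\<not> aff_dim (cell_component n \<Delta> \<rho> C i) < 0"
          using comp_ne[OF i] comp[OF i] by simp
        ultimately show ?thesis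
          by linarith
      qed
      then have "(\<Sum>i\<le>n. 1) \<le> (\<Sum>i\<le>n. aff_dim (cell_component n \<Delta> \<rho> C i))"
        by (intro sum_mono) simp
      then show False
        using tight C_cell by (auto simp: tight_def)
    qed
    moreover have "finite J"
      by (simp add: J_def)
    ultimately have "Max J \<in> J"
      by simp
    moreover have ri: "row_index n \<Delta> \<rho> \<delta> b = Max J"
      by (simp add: row_index_def cell1 J_def)
    moreover have "J = {i. i \<le> n \<and> aff_dim (cell_component n Dc \<rho> C i) = 0}"
      using comp_D by (auto simp: J_def)
    then have "row_index n Dc \<rho> \<delta> b = Max J"
      by (simp add: row_index_def cell2)
    ultimately show ?thesis
      using comp_D by (simp add: row_point_def cell1 cell2 J_def)
  qed

  have sub: "\<C>\<^sub>D \<subseteq> ce_index n M Dc \<delta>"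
    using CB CD by (auto simp: ce_index_def D_sum[symmetric])
  have sub': "\<C>\<^sub>D \<subseteq> ce_index n M \<Delta> \<delta>"
    using CB CD by blast
  define Z where "Z = {U i a | i a. i \<le> n \<and> a \<in> A i - Dc i}"
  have "is_evaluation Z
      (principal_submatrix (ce_matrix n M A \<Delta> \<rho> \<delta>) \<C>\<^sub>D (b, b'))
      (principal_submatrix (ce_matrix n M (\<lambda>i. A i \<inter> Dc i) Dc \<rho> \<delta>) \<C>\<^sub>D (b, b'))"
    if b: "b \<in> \<C>\<^sub>D" "b' \<in> \<C>\<^sub>D" for b b'
  proof -
    define i where "i = row_index n \<Delta> \<rho> \<delta> b"
    define a where "a = b' - b + row_point n \<Delta> \<rho> \<delta> b"
    have i: "i \<le> n"
      using same_cell[OF b(1)] by (simp add: i_def)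
    have e1: "principal_submatrix (ce_matrix n M A \<Delta> \<rho> \<delta>) \<C>\<^sub>D (b, b') = (if a \<in> A i then fvar i a else 0)"
      using b sub' by (auto simp: principal_submatrix_def ce_matrix_def Let_def i_def a_def)
    have e2: "principal_submatrix (ce_matrix n M (\<lambda>i. A i \<inter> Dc i) Dc \<rho> \<delta>) \<C>\<^sub>D (b, b') =
        (if a \<in> A i \<inter> Dc i then fvar i a else 0)"
      using b sub same_cell[OF b(1)]
      by (auto simp: principal_submatrix_def ce_matrix_def Let_def i_def a_def)
    have Z: "U i a \<in> Z \<longleftrightarrow> a \<in> A i - Dc i"
      using i by (auto simp: Z_def)
    show ?thesis
    proof (cases "a \<in> A i")
      case True
      then show ?thesis
        using is_evaluation_fvar[of Z i a] unfolding e1 e2 Z by auto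
    next
      case False
      then show ?thesis
        unfolding e1 e2 by (simp add: is_evaluation_zero)
    qed
  qed
  then show ?thesis
    using sub unfolding Z_def by blast
qed

end
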